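(* Let $n,N\in\mathbb{N}$ and $\lambda>0$. Let $\mathcal{B}\subset\mathbb{R}^n$ be a bounded set containing the origin, with uniform probability measure $\bar\mu_{\mathcal{B}}$. Let $\Upsilon\subset(\mathbb{R}^n\setminus\{0\})\times\mathbb{R}$ be a (known) bounded parameter set, with $\lambda$-expanded set $\Upsilon_\lambda$. Let $\sigma:\mathbb{R}\to\mathbb{R}$ be a nonlinear, almost everywhere continuous function which satisfies at least one of the following conditions, with a positive scalar $\mathscr{D}_\sigma$ or $\mathcal{L}_\sigma$: (1) $|\sigma(u)-\sigma(v)|\le \mathscr{D}_\sigma$ for all $u,v\in\mathcal{I}$; (2) $|\sigma(u)-\sigma(v)|\le \mathcal{L}_\sigma|u-v|$ for all $u,v\in\mathcal{I}$, where $\mathcal{I}=\{\gamma^\top X : \gamma\in\Upsilon,\ x\in\mathcal{B}\}$ and $X=[x_1\ \cdots\ x_n\ 1]^\top$. Let there exist a base approximation $$\widehat f_N(x)=\sum_{i=1}^N\theta_i\,\sigma(\gamma_i^\top X)$$ with some (unknown) parameters $\gamma_1,\dots,\gamma_N\in\Upsilon$ and (unknown) coefficients $\theta\in\mathbb{R}^N$ having a known bound $\sum_{i=1}^N|\theta_i|\le \mathcal{S}_N$. Then the mollified approximation $$\widehat f_{\lambda,N}(x)=\int_{\Upsilon_\lambda}\sum_{i=1}^N\theta_i\,\hat\delta_\lambda^{n+1}(\gamma-\gamma_i)\,\sigma(\gamma^\top X)\,d\gamma$$ satisfies: (i) if $\sigma$ satisfies (1), then $\|\widehat f_N-\widehat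 f_{\lambda,N}\|_{\mathcal{B}}\le \mathcal{S}_N\,\mathscr{D}_\sigma$; (ii) if $\sigma$ satisfies (2), then $\|\widehat f_N-\widehat f_{\lambda,N}\|_{\mathcal{B}}\le \mathcal{S}_N\,\dfrac{\mathcal{L}_\sigma\sqrt{n+1}}{\lambda}\,E_{\mathcal{B}}$.
   Context: For $x\in\mathbb{R}^n$, write $X=[x_1\ \cdots\ x_n\ 1]^\top\in\mathbb{R}^{n+1}$. Parameters are $\gamma=[w_1\ \cdots\ w_n\ b]^\top$ with weight vector $w$ and bias $b\in\mathbb{R}$, so that $\gamma^\top X=w^\top x+b$. $\bar\mu_{\mathcal{B}}$ is the uniform probability measure (normalized Lebesgue measure) on $\mathcal{B}$, and $\|g\|_{\mathcal{B}}=\left(\int_{\mathcal{B}}|g(x)|^2\,\bar\mu_{\mathcal{B}}(dx)\right)^{1/2}$. The constant $E_{\mathcal{B}}$ is $E_{\mathcal{B}}=\left(\int_{\mathcal{B}}\|X\|_2^2\,\bar\mu_{\mathcal{B}}(dx)\right)^{1/2}$. Mollified delta: for $\lambda>0$ and $\gamma=[w_1\ \cdots\ w_n\ b]^\top\in\mathbb{R}^{n+1}$, $$\hat\delta_\lambda^{n+1}(\gamma)=(\eta\lambda)^{n+1}\prod_{i=1}^n\exp\!\left(\frac{-1}{1-\lambda^2w_i^2}\right)\exp\!\left(\frac{-1}{1-\lambda^2b^2}\right)\quad\text{if }\gamma\in(-\tfrac1\lambda,\tfrac1\lambda)^{n+1},$$ and $\hat\delta_\lambda^{n+1}(\gamma)=0$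 otherwise, where $\eta^{-1}=\int_{-1}^1\exp\left(\frac{-1}{1-y^2}\right)dy$. Thus $\hat\delta_\lambda^{n+1}$ integrates to $1$ over $\mathbb{R}^{n+1}$. $\lambda$-expanded parameter set: $\Upsilon_\lambda=\overline{\Upsilon}+[-\tfrac1\lambda,\tfrac1\lambda]^{n+1}$ (Minkowski sum with the closure of $\Upsilon$). It contains the support of $\hat\delta_\lambda^{n+1}(\cdot-\gamma_i)$ for every $\gamma_i$ in $\Upsilon$ or on its boundary; for a rectangular box $\Upsilon$, each side interval $[\alpha,\beta]$ becomes $[\alpha-\frac1\lambda,\beta+\frac1\lambda]$.
   Formalization: Conditions (1) and (2) are required on the range {γᵀX : γ ∈ Υ_λ, x ∈ B} of the λ-expanded parameter set instead of on I defined with Υ, since the claim fails otherwise; B is taken Lebesgue measurable with positive measure. *)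

theory Defs
  imports "HOL-Analysis.Analysis"
begin

text \<open>
  The space of dimension \<open>n + 1\<close> (with \<open>n = CARD('n)\<close>) is rendered as the Euclidean product space
  \<open>(real ^ 'n) \<times> real\<close>: a parameter vector is the pair \<open>(w, b)\<close> of weight vector and bias, and
  \<open>(w, b) \<bullet> augment x = w \<bullet> x + b\<close>.
\<close>

definition augment :: "real ^ 'n \<Rightarrow> (real ^ 'n) \<times> real" where
  "augment x = (x, 1)"

text \<open>
  The pre-activation values \<open>\<gamma>\<^sup>T X\<close>. Regularity of the activation function has to be imposed on the
  range belonging to the expanded parameter set (\<open>expand\<close> below): the mollified approximation
  integrates over that set, so it evaluates the activation function outside the range belonging to
  the original parameter set, where a bound on the original range says nothing.
\<close>

definition arg_range :: "((real ^ 'n) \<times> real) set \<Rightarrow> (real ^ 'n) set \<Rightarrow> real set" where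
  "arg_range U B = {\<gamma> \<bullet> augment x | \<gamma> x. \<gamma> \<in> U \<and> x \<in> B}"

definition unif :: "(real ^ 'n) set \<Rightarrow> (real ^ 'n) measure" where
  "unif B = uniform_measure lebesgue B"

definition L2_norm_on :: "(real ^ 'n) set \<Rightarrow> (real ^ 'n \<Rightarrow> real) \<Rightarrow> real" where
  "L2_norm_on B g = sqrt (\<integral>x. \<bar>g x\<bar>\<^sup>2 \<partial>unif B)"

definition E_const :: "(real ^ 'n) set \<Rightarrow> real" where
  "E_const B = sqrt (\<integral>x. (norm (augment x))\<^sup>2 \<partial>unif B)"

definition bump_const :: real where
  "bump_const = inverse (LBINT y=-1..1. exp (- 1 / (1 - y\<^sup>2)))"

definition moll_delta :: "real \<Rightarrow> (real ^ 'n) \<times> real \<Rightarrow> real" where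
  "moll_delta l = (\<lambda>(w, b).
     if (\<forall>i. w $ i \<in> {- 1 / l <..< 1 / l}) \<and> b \<in> {- 1 / l <..< 1 / l}
     then (bump_const * l) ^ (CARD('n) + 1)
            * (\<Prod>i\<in>UNIV. exp (- 1 / (1 - l\<^sup>2 * (w $ i)\<^sup>2))) * exp (- 1 / (1 - l\<^sup>2 * b\<^sup>2))
     else 0)"

definition cube :: "real \<Rightarrow> ((real ^ 'n) \<times> real) set" where
  "cube r = {(w, b). (\<forall>i. w $ i \<in> {- r .. r}) \<and> b \<in> {- r .. r}}"

definition expand :: "real \<Rightarrow> ((real ^ 'n) \<times> real) set \<Rightarrow> ((real ^ 'n) \<times> real) set" where
  "expand l U = {\<gamma> + \<delta> | \<gamma> \<delta>. \<gamma> \<in> closure U \<and> \<delta> \<in> cube (1 / l)}"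

definition base_approx ::
  "(real \<Rightarrow> real) \<Rightarrow> nat \<Rightarrow> (nat \<Rightarrow> real) \<Rightarrow> (nat \<Rightarrow> (real ^ 'n) \<times> real) \<Rightarrow> real ^ 'n \<Rightarrow> real" where
  "base_approx \<sigma> N \<theta> \<gamma> x = (\<Sum>i=1..N. \<theta> i * \<sigma> (\<gamma> i \<bullet> augment x))"

definition moll_approx ::
  "real \<Rightarrow> ((real ^ 'n) \<times> real) set \<Rightarrow> (real \<Rightarrow> real) \<Rightarrow> nat \<Rightarrow> (nat \<Rightarrow> real)
     \<Rightarrow> (nat \<Rightarrow> (real ^ 'n) \<times> real) \<Rightarrow> real ^ 'n \<Rightarrow> real" where
  "moll_approx l U \<sigma> N \<theta> \<gamma> x =
     (LINT g:expand l U|lebesgue. (\<Sum>i=1..N. \<theta> i * moll_delta l (g - \<gamma> i) * \<sigma> (g \<bullet> augment x)))"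

definition oscillation_cond :: "(real \<Rightarrow> real) \<Rightarrow> real set \<Rightarrow> real \<Rightarrow> bool" where
  "oscillation_cond \<sigma> I D \<longleftrightarrow> D > 0 \<and> (\<forall>u\<in>I. \<forall>v\<in>I. \<bar>\<sigma> u - \<sigma> v\<bar> \<le> D)"

definition lipschitz_cond :: "(real \<Rightarrow> real) \<Rightarrow> real set \<Rightarrow> real \<Rightarrow> bool" where
  "lipschitz_cond \<sigma> I L \<longleftrightarrow> L > 0 \<and> (\<forall>u\<in>I. \<forall>v\<in>I. \<bar>\<sigma> u - \<sigma> v\<bar> \<le> L * \<bar>u - v\<bar>)"

end

theory Submission
  imports Defs "HOL-Probability.Probability_Measure"
begin

text \<open>
  The mollified delta is a probability density supported in a cube of half-width \<open>1 / l\<close>, so every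
  term of the mollified approximation replaces the value \<open>\<sigma> (\<gamma>\<^sub>i\<^sup>T X)\<close> by a weighted average of the
  values \<open>\<sigma> (\<gamma>\<^sup>T X)\<close> with \<open>\<gamma>\<close> in the cube around \<open>\<gamma>\<^sub>i\<close>. An average differs from a number by at most
  the largest deviation of the averaged values (\<open>mollified_average\<close>), and this cube lies inside the
  expanded parameter set, so restricting the integral to that set loses no mass. Summing with
  weights \<open>\<theta>\<^sub>i\<close> gives a bound for each \<open>x \<in> B\<close> (\<open>base_minus_moll_bound\<close>): \<open>S\<close> times the deviation, which
  is at most \<open>D\<close> under the oscillation condition and, by Cauchy-Schwarz, at most
  \<open>L * (sqrt (n + 1) / l) * norm X\<close> under the Lipschitz condition. Taking the quadratic mean over \<open>B\<close>
  turns these into the two claims.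

  Two facts need an argument. The total mass is one because the delta is the product over all
  coordinates of one and the same rescaled bump, so that its integral is a power of a
  one-dimensional integral. The averages exist because \<open>\<gamma> \<mapsto> \<sigma> (\<gamma>\<^sup>T X)\<close> is Lebesgue measurable:
  the last component of \<open>X\<close> is \<open>1\<close>, so on every line parallel to the bias axis \<open>\<gamma>\<^sup>T X\<close> is a
  translation of the bias. By Fubini the parameters that are sent into the null set of
  discontinuities of \<open>\<sigma>\<close> form a null set.
\<close>

section \<open>The mollified delta as a probability density\<close>

text \<open>
  The constant \<open>bump_const * l\<close> is put into every factor, which makes the mollified delta a plain
  product over the coordinates.
\<close>
definition bump :: "real \<Rightarrow> real \<Rightarrow> real" where
  "bump l y = (if y \<in> {- 1 / l <..< 1 / l} then bump_const * l * exp (- 1 / (1 - l\<^sup>2 * y\<^sup>2)) else 0)"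

text \<open>
  Lebesgue measure on a Euclidean space is the image of the product measure on the coordinates, so
  this is Fubini for a product of functions of separate coordinates.
\<close>
lemma has_bochner_integral_prod_coordinates:
  fixes f :: "real \<Rightarrow> real"
  assumes f: "integrable lborel f"
  shows "has_bochner_integral lborel (\<lambda>x::'a::euclidean_space. \<Prod>b\<in>Basis. f (x \<bullet> b))
           ((\<integral>y. f y \<partial>lborel) ^ DIM('a))"
proof -
  interpret product_sigma_finite "\<lambda>b::'a. lborel :: real measure" by standard
  have [measurable]: "f \<in> borel_measurable borel" using f by auto
  have coord: "(\<Prod>b\<in>Basis. f ((\<Sum>c\<in>Basis. h c *\<^sub>R c) \<bullet> b)) = (\<Prod>b\<in>Basis. f (h b))" for h :: "'a \<Rightarrow> real"
    by (intro prod.cong) auto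
  have "integrable (\<Pi>\<^sub>M b\<in>(Basis :: 'a set). lborel) (\<lambda>h. \<Prod>b\<in>Basis. f (h b))"
    using f by (intro product_integrable_prod) auto
  moreover have "(\<integral>h. (\<Prod>b\<in>Basis. f (h b)) \<partial>(\<Pi>\<^sub>M b\<in>(Basis :: 'a set). lborel)) = (\<integral>y. f y \<partial>lborel) ^ DIM('a)"
    using product_integral_prod[of "Basis :: 'a set" "\<lambda>_. f"] f by simp
  ultimately show ?thesis
    unfolding has_bochner_integral_iff
    by (subst (1 2) lborel_eq) (simp add: integrable_distr_eq integral_distr coord)
qed

lemma bump_profile_integrable:
  "set_integrable lborel {-1<..<1} (\<lambda>y::real. exp (- 1 / (1 - y\<^sup>2)))"
proof -
  have "norm (exp (- 1 / (1 - y\<^sup>2))) \<le> 1" if "y \<in> {-1<..<1}" for y :: real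
  proof -
    have "y\<^sup>2 < 1" using that abs_square_less_1[of y] by auto
    then show ?thesis by simp
  qed
  then show ?thesis unfolding set_integrable_def
    by (intro integrableI_bounded_set_indicator[where B = 1]) auto
qed

lemma bump_const_eq:
  "bump_const = inverse (LBINT y:{-1<..<1}. exp (- 1 / (1 - y\<^sup>2)))"
proof -
  have "einterval (-1) 1 = {-1<..<1}" by (auto simp: einterval_def one_ereal_def)
  moreover have "(-1 :: ereal) \<le> 1" by (simp add: one_ereal_def)
  ultimately show ?thesis by (simp add: bump_const_def interval_lebesgue_integral_def)
qed

text \<open>
  The normalising constant is an inverse, and the inverse of \<open>0\<close> is \<open>0\<close>; total mass one therefore needs
  the bump integral to be strictly positive.
\<close>
lemma bump_const_pos: "bump_const > 0"
proof -
  \<comment> \<open>On the middle half the profile is smallest at the endpoints, where it equals \<open>exp (- 4 / 3)\<close>.\<close>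
  have "(LBINT y:{-1/2..1/2::real}. exp (- 4 / 3 :: real)) \<le> (LBINT y:{-1<..<1}. exp (- 1 / (1 - y\<^sup>2)))"
    unfolding set_lebesgue_integral_def
  proof (rule integral_mono)
    fix y :: real
    have "exp (- 4 / 3) \<le> exp (- 1 / (1 - y\<^sup>2))" if "y \<in> {-1/2..1/2}"
    proof -
      have "y\<^sup>2 \<le> (1/2)\<^sup>2" using that by (intro power2_le_iff_abs_le[THEN iffD2]) auto
      then show ?thesis by (simp add: field_simps power2_eq_square)
    qed
    then show "indicator {-1/2..1/2} y *\<^sub>R exp (- 4 / 3) \<le> indicator {-1<..<1} y *\<^sub>R exp (- 1 / (1 - y\<^sup>2))"
      by (auto simp: indicator_def)
  qed (use bump_profile_integrable in \<open>auto simp: set_integrable_def\<close>)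
  moreover have "(LBINT y:{-1/2..1/2::real}. exp (- 4 / 3 :: real)) > 0"
    by (simp add: set_lebesgue_integral_def)
  ultimately show ?thesis unfolding bump_const_eq by simp
qed

lemma bump_nonneg: "l > 0 \<Longrightarrow> bump l y \<ge> 0"
  using bump_const_pos by (simp add: bump_def)

lemma has_integral_bump:
  assumes "l > 0"
  shows "has_bochner_integral lborel (bump l) 1"
proof -
  let ?p = "\<lambda>y. indicator {-1<..<1} y *\<^sub>R exp (- 1 / (1 - y\<^sup>2)) :: real"
  have eq: "bump l y = bump_const * l * ?p (0 + l * y)" for y
    using assms by (auto simp: bump_def indicator_def field_simps power_mult_distrib)
  have int: "integrable lborel ?p" using bump_profile_integrable by (simp add: set_integrable_def)
  have "integrable lborel (\<lambda>y. ?p (0 + l * y))"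
    using assms int by (intro lborel_integrable_real_affine) auto
  moreover have "(\<integral>y. ?p y \<partial>lborel) = l * (\<integral>y. ?p (0 + l * y) \<partial>lborel)"
    using lborel_integral_real_affine[of l ?p 0] assms by simp
  moreover have "bump_const * (\<integral>y. ?p y \<partial>lborel) = 1"
    using bump_const_pos unfolding bump_const_eq set_lebesgue_integral_def by simp
  ultimately show ?thesis
    unfolding has_bochner_integral_iff eq[abs_def] by (simp add: mult.assoc)
qed

lemma moll_delta_eq_prod_bump:
  fixes g :: "(real ^ 'n) \<times> real"
  shows "moll_delta l g = (\<Prod>b\<in>Basis. bump l (g \<bullet> b))"
proof -
  obtain w c where g: "g = (w, c)" by (cases g)
  have inj: "inj (\<lambda>i::'n. axis i (1::real))" by (simp add: inj_on_def axis_eq_axis)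
  have vec: "(\<Prod>b\<in>Basis. bump l (w \<bullet> b)) = (\<Prod>i\<in>UNIV. bump l (w $ i))"
    by (simp add: Basis_vec_def UNION_singleton_eq_range prod.reindex[OF inj] inner_axis)
  have "(\<Prod>b\<in>Basis. bump l (g \<bullet> b)) = (\<Prod>b\<in>(\<lambda>u. (u, 0)) ` (Basis :: (real^'n) set). bump l (g \<bullet> b)) *
      (\<Prod>b\<in>(\<lambda>u. (0, u)) ` (Basis :: real set). bump l (g \<bullet> b))"
    unfolding Basis_prod_def by (intro prod.union_disjoint) auto
  also have "\<dots> = (\<Prod>i\<in>UNIV. bump l (w $ i)) * bump l c"
    by (simp add: prod.reindex inj_on_def g vec)
  also have "\<dots> = moll_delta l g"
    by (auto simp: moll_delta_def g bump_def prod.distrib power_mult_distrib)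
  finally show ?thesis ..
qed

text \<open>
  Product structure and total mass one of the one-dimensional factor; the shift is harmless by
  translation invariance.
\<close>
lemma has_integral_moll_delta_shift:
  fixes c :: "(real ^ 'n) \<times> real"
  assumes "l > 0"
  shows "has_bochner_integral lborel (\<lambda>g. moll_delta l (g - c)) 1"
proof -
  have "has_bochner_integral lborel (moll_delta l :: (real ^ 'n) \<times> real \<Rightarrow> real) 1"
    using has_bochner_integral_prod_coordinates[of "bump l", where 'a = "(real ^ 'n) \<times> real"] has_integral_bump[OF assms]
    by (simp add: has_bochner_integral_iff moll_delta_eq_prod_bump[abs_def])
  moreover from this have [measurable]: "moll_delta l \<in> borel_measurable (borel :: ((real ^ 'n) \<times> real) measure)"
    by (auto simp: has_bochner_integral_iff dest: borel_measurable_integrable)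
  ultimately have "has_bochner_integral (distr lborel borel ((+) (- c))) (moll_delta l) 1"
    by (simp add: lborel_distr_plus)
  then show ?thesis
    by (auto simp: has_bochner_integral_iff integrable_distr_eq integral_distr)
qed

lemma moll_delta_nonneg: "l > 0 \<Longrightarrow> moll_delta l g \<ge> 0"
  by (simp add: moll_delta_eq_prod_bump bump_nonneg prod_nonneg)

lemma moll_delta_support:
  assumes "moll_delta l g \<noteq> 0" shows "g \<in> cube (1 / l)"
  using assms by (auto simp: moll_delta_def cube_def less_imp_le split: if_splits prod.splits)

text \<open>
  Half the diagonal of the cube: the source of the factor \<open>sqrt (n + 1)\<close> in the Lipschitz bound.
\<close>
lemma norm_le_cube:
  fixes g :: "(real ^ 'n) \<times> real"
  assumes "g \<in> cube r"
  shows "norm g \<le> sqrt (real (CARD('n) + 1)) * r"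
proof -
  obtain w c where g: "g = (w, c)" by (cases g)
  have r: "\<bar>w $ i\<bar> \<le> r" "\<bar>c\<bar> \<le> r" for i
    using assms by (auto simp: g cube_def abs_le_iff minus_le_iff)
  then have "r \<ge> 0" by (meson abs_ge_zero order_trans)
  have "(norm g)\<^sup>2 = (\<Sum>i\<in>UNIV. (w $ i)\<^sup>2) + c\<^sup>2"
    by (simp add: g norm_Pair norm_vec_def L2_set_def sum_nonneg)
  also have "\<dots> \<le> (\<Sum>i\<in>(UNIV :: 'n set). r\<^sup>2) + r\<^sup>2"
    using r by (intro add_mono sum_mono) (auto simp: abs_le_square_iff[symmetric])
  also have "\<dots> = (sqrt (real (CARD('n) + 1)) * r)\<^sup>2"
    by (simp add: power_mult_distrib algebra_simps)
  finally show ?thesis by (rule power2_le_imp_le) (use \<open>r \<ge> 0\<close> in simp)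
qed

section \<open>Measurability in the parameters\<close>

text \<open>
  Fubini over weight and bias: for a fixed weight the pre-activation is a translation of the bias,
  and translations preserve null sets.
\<close>
lemma AE_inner_augment:
  fixes x :: "real ^ 'n"
  assumes "AE u in lebesgue. P u"
  shows "AE g in lborel. P (g \<bullet> augment x)"
proof -
  \<comment> \<open>A Borel null set, because the condition below must be measurable for the product measure.\<close>
  obtain Z where Z: "Z \<in> null_sets lborel" and P: "\<And>u. u \<notin> Z \<Longrightarrow> P u"
    using assms unfolding AE_completion_iff unfolding eventually_ae_filter by auto
  then have [measurable]: "Z \<in> sets borel" by auto
  have line: "AE b in lborel. a + b \<notin> Z" for a :: real
  proof -
    have "AE u in distr lborel borel ((+) a). u \<notin> Z"
      using Z by (simp add: lborel_distr_plus AE_not_in)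
    then show ?thesis by (subst (asm) AE_distr_iff) auto
  qed
  have "AE g in lborel \<Otimes>\<^sub>M lborel. g \<bullet> augment x \<notin> Z"
  proof (rule lborel_pair.AE_pair_measure)
    show "{g \<in> space (lborel \<Otimes>\<^sub>M lborel). g \<bullet> augment x \<notin> Z} \<in> sets (lborel \<Otimes>\<^sub>M lborel)"
      unfolding lborel_prod by measurable
    show "AE w in lborel. AE b in lborel. (w, b) \<bullet> augment x \<notin> Z"
      using line by (simp add: augment_def)
  qed
  then show ?thesis unfolding lborel_prod using P by auto
qed

text \<open>
  Lebesgue measurability is in general not preserved by composing on the right, even with a linear
  map. Here \<open>\<sigma>\<close> is continuous, hence Borel, off a Borel null set \<open>Z\<close>, and the preimage of \<open>Z\<close> is
  negligible.
\<close>
lemma measurable_inner_augment: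
  fixes \<sigma> :: "real \<Rightarrow> real"
  assumes "AE u in lebesgue. isCont \<sigma> u"
  shows "(\<lambda>g. \<sigma> (g \<bullet> augment x)) \<in> borel_measurable lebesgue"
proof -
  obtain Z where Z: "Z \<in> null_sets lborel" and cont: "\<And>u. u \<notin> Z \<Longrightarrow> isCont \<sigma> u"
    using assms unfolding AE_completion_iff unfolding eventually_ae_filter by auto
  have "continuous_on (- Z) \<sigma>" using cont by (auto intro: continuous_at_imp_continuous_on)
  then have s[measurable]: "(\<lambda>u. indicator (- Z) u *\<^sub>R \<sigma> u) \<in> borel_measurable borel"
    using Z by (intro borel_measurable_continuous_on_indicator) auto
  have "AE u in lebesgue. u \<notin> Z" using Z by (intro AE_completion AE_not_in)
  then have "AE g in lebesgue. g \<bullet> augment x \<notin> Z"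
    by (rule AE_completion[OF AE_inner_augment])
  then have "AE g in lebesgue. indicator (- Z) (g \<bullet> augment x) *\<^sub>R \<sigma> (g \<bullet> augment x) = \<sigma> (g \<bullet> augment x)"
    by eventually_elim simp
  moreover have "(\<lambda>g. indicator (- Z) (g \<bullet> augment x) *\<^sub>R \<sigma> (g \<bullet> augment x)) \<in> borel_measurable lebesgue"
    by (intro measurable_completion measurable_compose[OF _ s]) measurable
  ultimately show ?thesis by (rule borel_measurable_AE[rotated])
qed

section \<open>The pointwise error\<close>

text \<open>
  The deviation bound has to hold only on the support of the density, and it is also what makes the
  product integrable: \<open>\<sigma>\<close> may be unbounded elsewhere.
\<close>
lemma mollified_average:
  fixes c :: "(real ^ 'n) \<times> real" and \<sigma> :: "real \<Rightarrow> real"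
  assumes l: "l > 0" and \<sigma>: "AE u in lebesgue. isCont \<sigma> u"
    and close: "\<And>g. g - c \<in> cube (1 / l) \<Longrightarrow> \<bar>s - \<sigma> (g \<bullet> augment x)\<bar> \<le> K"
  shows "integrable lebesgue (\<lambda>g. moll_delta l (g - c) * \<sigma> (g \<bullet> augment x))"
    and "\<bar>s - (\<integral>g. moll_delta l (g - c) * \<sigma> (g \<bullet> augment x) \<partial>lebesgue)\<bar> \<le> K"
proof -
  let ?d = "\<lambda>g. moll_delta l (g - c)" and ?h = "\<lambda>g. s - \<sigma> (g \<bullet> augment x)"
  have d: "has_bochner_integral lborel ?d 1" by (rule has_integral_moll_delta_shift[OF l])
  then have d_meas: "?d \<in> borel_measurable lborel" by auto
  then have [measurable]: "?d \<in> borel_measurable lebesgue" by (rule measurable_completion)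
  have d_int: "integrable lebesgue ?d" and d_1: "integral\<^sup>L lebesgue ?d = 1"
    using d d_meas by (auto simp: has_bochner_integral_iff integrable_completion integral_completion)
  have [measurable]: "(\<lambda>g. \<sigma> (g \<bullet> augment x)) \<in> borel_measurable lebesgue"
    by (rule measurable_inner_augment[OF \<sigma>])
  have bd: "\<bar>?d g * ?h g\<bar> \<le> K * ?d g" for g
  proof (cases "?d g = 0")
    case False
    then have "\<bar>?h g\<bar> \<le> K" by (intro close moll_delta_support)
    then show ?thesis
      using mult_right_mono[of "\<bar>?h g\<bar>" K "?d g"] moll_delta_nonneg[OF l, of "g - c"]
      by (simp add: abs_mult mult.commute)
  qed simp
  have dh_int: "integrable lebesgue (\<lambda>g. ?d g * ?h g)"
  proof (rule Bochner_Integration.integrable_bound)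
    show "integrable lebesgue (\<lambda>g. K * ?d g)" using d_int by simp
    show "AE g in lebesgue. norm (?d g * ?h g) \<le> norm (K * ?d g)"
      using order_trans[OF bd abs_ge_self] by simp
  qed measurable
  \<comment> \<open>As the density has mass one, the constant \<open>s\<close> is its own average.\<close>
  have split: "?d g * \<sigma> (g \<bullet> augment x) = s * ?d g - ?d g * ?h g" for g
    by (simp add: algebra_simps)
  show "integrable lebesgue (\<lambda>g. ?d g * \<sigma> (g \<bullet> augment x))"
    unfolding split using d_int dh_int by simp
  have "s - (\<integral>g. ?d g * \<sigma> (g \<bullet> augment x) \<partial>lebesgue) = (\<integral>g. ?d g * ?h g \<partial>lebesgue)"
    unfolding split using d_int dh_int d_1 by simp
  also have "\<bar>\<dots>\<bar> \<le> (\<integral>g. \<bar>?d g * ?h g\<bar> \<partial>lebesgue)" by (rule integral_abs_bound)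
  also have "\<dots> \<le> (\<integral>g. K * ?d g \<partial>lebesgue)"
    using d_int dh_int bd by (intro integral_mono) auto
  also have "\<dots> = K" using d_1 by simp
  finally show "\<bar>s - (\<integral>g. ?d g * \<sigma> (g \<bullet> augment x) \<partial>lebesgue)\<bar> \<le> K" .
qed

lemma expand_memI:
  assumes "c \<in> U" "g - c \<in> cube (1 / l)" shows "g \<in> expand l U"
proof -
  have "g = c + (g - c)" "c \<in> closure U" using assms closure_subset by auto
  then show ?thesis unfolding expand_def using assms(2) by blast
qed

text \<open>
  The common core of both claims: \<open>K\<close> may depend on \<open>x\<close>, and is chosen constant for the oscillation
  bound and proportional to the norm of \<open>X\<close> for the Lipschitz bound.
\<close>
lemma base_minus_moll_bound:
  fixes \<gamma> :: "nat \<Rightarrow> (real ^ 'n) \<times> real" and \<sigma> :: "real \<Rightarrow> real"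
  assumes l: "l > 0" and \<sigma>: "AE u in lebesgue. isCont \<sigma> u"
    and \<gamma>: "\<forall>i\<in>{1..N}. \<gamma> i \<in> U" and S: "(\<Sum>i=1..N. \<bar>\<theta> i\<bar>) \<le> S" and K: "K \<ge> 0"
    and close: "\<And>i g. i \<in> {1..N} \<Longrightarrow> g - \<gamma> i \<in> cube (1 / l)
                  \<Longrightarrow> \<bar>\<sigma> (\<gamma> i \<bullet> augment x) - \<sigma> (g \<bullet> augment x)\<bar> \<le> K"
  shows "\<bar>base_approx \<sigma> N \<theta> \<gamma> x - moll_approx l U \<sigma> N \<theta> \<gamma> x\<bar> \<le> S * K"
proof -
  let ?d = "\<lambda>i g. moll_delta l (g - \<gamma> i) * \<sigma> (g \<bullet> augment x)"
  have int: "integrable lebesgue (?d i)"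
    and avg: "\<bar>\<sigma> (\<gamma> i \<bullet> augment x) - (\<integral>g. ?d i g \<partial>lebesgue)\<bar> \<le> K" if "i \<in> {1..N}" for i
    using mollified_average[OF l \<sigma> close[OF that]] by blast+
  \<comment> \<open>The density already vanishes off the expanded set, so its indicator can be dropped.\<close>
  have "indicator (expand l U) g *\<^sub>R (\<theta> i * moll_delta l (g - \<gamma> i) * \<sigma> (g \<bullet> augment x)) = \<theta> i * ?d i g"
    if "i \<in> {1..N}" for i g
  proof (cases "g \<in> expand l U")
    case False
    then have "moll_delta l (g - \<gamma> i) = 0" using expand_memI moll_delta_support \<gamma> that by blast
    then show ?thesis by simp
  qed simp
  then have "moll_approx l U \<sigma> N \<theta> \<gamma> x = (\<integral>g. (\<Sum>i=1..N. \<theta> i * ?d i g) \<partial>lebesgue)"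
    unfolding moll_approx_def set_lebesgue_integral_def scaleR_sum_right
    by (intro Bochner_Integration.integral_cong refl sum.cong) auto
  also have "\<dots> = (\<Sum>i=1..N. \<theta> i * (\<integral>g. ?d i g \<partial>lebesgue))"
    using int by (subst Bochner_Integration.integral_sum) auto
  finally have "base_approx \<sigma> N \<theta> \<gamma> x - moll_approx l U \<sigma> N \<theta> \<gamma> x
      = (\<Sum>i=1..N. \<theta> i * (\<sigma> (\<gamma> i \<bullet> augment x) - (\<integral>g. ?d i g \<partial>lebesgue)))"
    by (simp add: base_approx_def sum_subtractf right_diff_distrib)
  also have "\<bar>\<dots>\<bar> \<le> (\<Sum>i=1..N. \<bar>\<theta> i\<bar> * K)"
    unfolding abs_mult[symmetric]
    by (rule order_trans[OF sum_abs], rule sum_mono)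
       (use avg in \<open>simp add: abs_mult mult_left_mono\<close>)
  also have "\<dots> \<le> S * K"
    using S K by (simp add: sum_distrib_right[symmetric] mult_right_mono)
  finally show ?thesis .
qed

section \<open>The quadratic mean\<close>

text \<open>
  Only the bounding function has to be square integrable: if the square of \<open>f\<close> is not integrable, its
  integral is \<open>0\<close> by convention, and the inequality holds as well.
\<close>
lemma L2_norm_on_mono:
  assumes "B \<in> sets lebesgue" "integrable (unif B) (\<lambda>x. (h x)\<^sup>2)"
    and "\<And>x. x \<in> B \<Longrightarrow> \<bar>f x\<bar> \<le> h x"
  shows "L2_norm_on B f \<le> L2_norm_on B h"
proof -
  have "\<bar>f x\<bar>\<^sup>2 \<le> \<bar>h x\<bar>\<^sup>2" if "x \<in> B" for x
    using order_trans[OF assms(3)[OF that] abs_ge_self] by (intro power_mono) auto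
  then have "AE x in unif B. \<bar>f x\<bar>\<^sup>2 \<le> \<bar>h x\<bar>\<^sup>2"
    unfolding unif_def using assms(1) by (intro AE_uniform_measureI AE_I2) auto
  then show ?thesis unfolding L2_norm_on_def
    using assms(2) by (intro real_sqrt_le_mono integral_mono_AE') auto
qed

lemma L2_norm_on_cmult: "c \<ge> 0 \<Longrightarrow> L2_norm_on B (\<lambda>x. c * h x) = c * L2_norm_on B h"
  by (simp add: L2_norm_on_def abs_mult power_mult_distrib real_sqrt_mult)

lemma finite_emeasure_bounded:
  fixes B :: "(real ^ 'n) set"
  assumes "bounded B" "B \<in> sets lebesgue"
  shows "emeasure lebesgue B < \<infinity>"
  using bounded_set_imp_lmeasurable[OF assms] unfolding fmeasurable_def by blast

lemma prob_space_unif: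
  assumes "bounded B" "B \<in> sets lebesgue" "emeasure lebesgue B > 0"
  shows "prob_space (unif B)"
  unfolding unif_def using assms finite_emeasure_bounded[of B]
  by (intro prob_space_uniform_measure) auto

section \<open>The error bounds\<close>

theorem theorem1:
  fixes B :: "(real ^ 'n) set"
    and U :: "((real ^ 'n) \<times> real) set"
    and \<sigma> :: "real \<Rightarrow> real"
    and N :: nat
    and \<theta> :: "nat \<Rightarrow> real"
    and \<gamma> :: "nat \<Rightarrow> (real ^ 'n) \<times> real"
    and l S D L :: real
  assumes "l > 0"
    and "bounded B" "0 \<in> B" "B \<in> sets lebesgue" "emeasure lebesgue B > 0"
    and "U \<subseteq> (UNIV - {0}) \<times> UNIV" "bounded U"
    and "\<not> linear \<sigma>" "AE u in lebesgue. isCont \<sigma> u"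
    and "oscillation_cond \<sigma> (arg_range (expand l U) B) D
           \<or> lipschitz_cond \<sigma> (arg_range (expand l U) B) L"
    and "\<forall>i\<in>{1..N}. \<gamma> i \<in> U"
    and "(\<Sum>i=1..N. \<bar>\<theta> i\<bar>) \<le> S"
  shows "(oscillation_cond \<sigma> (arg_range (expand l U) B) D \<longrightarrow>
            L2_norm_on B (\<lambda>x. base_approx \<sigma> N \<theta> \<gamma> x - moll_approx l U \<sigma> N \<theta> \<gamma> x) \<le> S * D)
       \<and> (lipschitz_cond \<sigma> (arg_range (expand l U) B) L \<longrightarrow>
            L2_norm_on B (\<lambda>x. base_approx \<sigma> N \<theta> \<gamma> x - moll_approx l U \<sigma> N \<theta> \<gamma> x)
              \<le> S * (L * sqrt (real (CARD('n) + 1)) / l) * E_const B)"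
proof -
  let ?e = "\<lambda>x. base_approx \<sigma> N \<theta> \<gamma> x - moll_approx l U \<sigma> N \<theta> \<gamma> x"
  let ?I = "arg_range (expand l U) B" and ?C = "S * (L * sqrt (real (CARD('n) + 1)) / l)"
  have S: "S \<ge> 0" using assms(12) by (rule order_trans[rotated]) (simp add: sum_nonneg)
  interpret unif: prob_space "unif B" using assms by (intro prob_space_unif)
  have in_range: "g \<bullet> augment x \<in> ?I" if "x \<in> B" "i \<in> {1..N}" "g - \<gamma> i \<in> cube (1 / l)" for x i g
    using that(1) expand_memI[OF bspec[OF assms(11) that(2)] that(3)] unfolding arg_range_def by blast
  have zero_cube: "\<gamma> i - \<gamma> i \<in> cube (1 / l)" for i
    using assms(1) by (simp add: cube_def zero_prod_def)
  note err = base_minus_moll_bound[OF assms(1,9,11,12)]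
  show ?thesis
  proof (intro conjI impI)
    assume osc: "oscillation_cond \<sigma> ?I D"
    then have "D > 0" by (simp add: oscillation_cond_def)
    have "\<bar>?e x\<bar> \<le> S * D" if x: "x \<in> B" for x
    proof (rule err)
      fix i g assume i: "i \<in> {1..N}" and g: "g - \<gamma> i \<in> cube (1 / l)"
      show "\<bar>\<sigma> (\<gamma> i \<bullet> augment x) - \<sigma> (g \<bullet> augment x)\<bar> \<le> D"
        using osc in_range[OF x i g] in_range[OF x i zero_cube] by (simp add: oscillation_cond_def)
    qed (use \<open>D > 0\<close> in simp)
    then have "L2_norm_on B ?e \<le> L2_norm_on B (\<lambda>x. S * D)"
      using assms(4) by (intro L2_norm_on_mono) auto
    also have "\<dots> = S * D"
      using S \<open>D > 0\<close> by (simp add: L2_norm_on_def unif.prob_space)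
    finally show "L2_norm_on B ?e \<le> S * D" .
  next
    assume lip: "lipschitz_cond \<sigma> ?I L"
    then have "L > 0" by (simp add: lipschitz_cond_def)
    have C: "?C \<ge> 0" using S \<open>L > 0\<close> assms(1) by simp
    have e: "\<bar>?e x\<bar> \<le> ?C * norm (augment x)" if x: "x \<in> B" for x
    proof -
      have "\<bar>\<sigma> (\<gamma> i \<bullet> augment x) - \<sigma> (g \<bullet> augment x)\<bar>
              \<le> L * (sqrt (real (CARD('n) + 1)) * (1 / l) * norm (augment x))"
        if i: "i \<in> {1..N}" and g: "g - \<gamma> i \<in> cube (1 / l)" for i g
      proof -
        have "\<bar>\<sigma> (\<gamma> i \<bullet> augment x) - \<sigma> (g \<bullet> augment x)\<bar> \<le> L * \<bar>\<gamma> i \<bullet> augment x - g \<bullet> augment x\<bar>"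
          using lip in_range[OF x i g] in_range[OF x i zero_cube] by (simp add: lipschitz_cond_def)
        also have "\<bar>\<gamma> i \<bullet> augment x - g \<bullet> augment x\<bar> = \<bar>(g - \<gamma> i) \<bullet> augment x\<bar>"
          by (simp add: inner_diff_left abs_minus_commute)
        also have "\<dots> \<le> norm (g - \<gamma> i) * norm (augment x)" by (rule Cauchy_Schwarz_ineq2)
        also have "\<dots> \<le> sqrt (real (CARD('n) + 1)) * (1 / l) * norm (augment x)"
          by (intro mult_right_mono norm_le_cube g) simp
        finally show ?thesis using \<open>L > 0\<close> by (simp add: mult_left_mono)
      qed
      then have "\<bar>?e x\<bar> \<le> S * (L * (sqrt (real (CARD('n) + 1)) * (1 / l) * norm (augment x)))"
        by (intro err) (use \<open>L > 0\<close> assms(1) in simp)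
      then show ?thesis by (simp add: mult_ac)
    qed
    \<comment> \<open>Boundedness of \<open>B\<close> makes \<open>norm X\<close> square integrable; otherwise \<open>E_const B\<close> could be \<open>0\<close>.\<close>
    obtain R where R: "\<And>x. x \<in> B \<Longrightarrow> norm x \<le> R" using assms(2) by (auto simp: bounded_iff)
    have "integrable (unif B) (\<lambda>x. (norm (augment x))\<^sup>2)"
    proof (rule unif.integrable_const_bound)
      show "AE x in unif B. norm ((norm (augment x))\<^sup>2) \<le> R\<^sup>2 + 1"
        unfolding unif_def using assms(4) R
        by (intro AE_uniform_measureI AE_I2) (auto simp: augment_def norm_Pair intro!: power_mono)
      have "(\<lambda>x. (norm (augment x))\<^sup>2) \<in> borel_measurable (lborel :: (real ^ 'n) measure)"
        unfolding augment_def by measurable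
      then show "(\<lambda>x. (norm (augment x))\<^sup>2) \<in> borel_measurable (unif B)"
        unfolding unif_def measurable_cong_sets[OF sets_uniform_measure refl]
        by (rule measurable_completion)
    qed
    then have "integrable (unif B) (\<lambda>x. (?C * norm (augment x))\<^sup>2)"
      by (simp only: power_mult_distrib integrable_mult_right)
    then have "L2_norm_on B ?e \<le> L2_norm_on B (\<lambda>x. ?C * norm (augment x))"
      using assms(4) e by (intro L2_norm_on_mono)
    also have "\<dots> = ?C * E_const B"
      unfolding L2_norm_on_cmult[OF C] by (simp add: L2_norm_on_def E_const_def)
    finally show "L2_norm_on B ?e \<le> ?C * E_const B" .
  qed
qed

end
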